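(* Let $n>1$ be an integer. There is an explicit bijection between the set $\mathcal{B}(n)$ of binary de Bruijn sequences of degree $n$ and the set of binary sequences of length $2^{n-1}$.
   Context: A binary de Bruijn sequence of degree $n$ is a sequence $b_0b_1\ldots b_{2^n-1}\in\{0,1\}^{2^n}$, read cyclically (indices modulo $2^n$), such that every binary string of length $n$ occurs exactly once as a cyclic window $b_ib_{i+1}\ldots b_{i+n-1}$, $0\le i\le 2^n-1$. Different rotations of the same cyclic sequence are counted as different elements of $\mathcal{B}(n)$ (so that $|\mathcal{B}(n)|=2^{2^{n-1}}$; e.g. for $n=2$, $0011$ is one such sequence). *)

theory Defs
  imports Main
begin

text \<open>Binary strings and sequences are boolean lists, with \<open>True\<close> for 1 and \<open>False\<close> for 0.\<close>

definition window :: "bool list \<Rightarrow> nat \<Rightarrow> nat \<Rightarrow> bool list" where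
  "window b k i = map (\<lambda>j. b ! ((i + j) mod length b)) [0..<k]"

text \<open>Sequences are not identified up to rotation.\<close>

definition de_bruijn_seqs :: "nat \<Rightarrow> bool list set" where
  "de_bruijn_seqs n =
     {b. length b = 2 ^ n \<and> (\<forall>w. length w = n \<longrightarrow> (\<exists>!i. i < 2 ^ n \<and> window b n i = w))}"

text \<open>
  The rest of this theory gives an executable map from the de Bruijn sequences of degree \<open>n\<close> to
  the bit strings of length \<open>2 ^ (n - 1)\<close>.

  Let \<open>D m\<close> be the digraph whose vertices are the words of length \<open>m\<close>, with an edge from \<open>v\<close> to
  \<open>tl v @ [c]\<close> for each bit \<open>c\<close> when \<open>m > 0\<close>, and two loops at the single vertex when \<open>m = 0\<close>.
  The graph \<open>D (Suc m)\<close> is the line graph of \<open>D m\<close>: a word \<open>f\<close> of length \<open>Suc m\<close> is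
  the edge of \<open>D m\<close> from \<open>butlast f\<close> to \<open>tl f\<close>.

  A spanning tree of \<open>D m\<close> directed towards a root \<open>r\<close> is encoded by \<open>r\<close> and a function \<open>p\<close>:
  the parent of a vertex \<open>v \<noteq> r\<close> is \<open>tl v @ [p v]\<close>. The values of \<open>p\<close> at \<open>r\<close> and at lists that
  are not vertices carry no information.
\<close>

text \<open>All words of length \<open>m\<close> in lexicographic order, which is the order used to choose leaves.\<close>

fun words :: "nat \<Rightarrow> bool list list" where
  "words 0 = [[]]"
| "words (Suc m) = map (Cons False) (words m) @ map (Cons True) (words m)"

text \<open>
  Pruefer-style pruning of the tree \<open>(r, p)\<close> restricted to the vertices in \<open>S\<close>: the smallest leaf
  is deleted until only the root is left. The result lists the vertices in order of deletion.
\<close>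

function prune_order :: "bool list \<Rightarrow> (bool list \<Rightarrow> bool) \<Rightarrow> bool list list \<Rightarrow> bool list list" where
  "prune_order r p S =
     (case find (\<lambda>v. v \<noteq> r \<and> (\<forall>u\<in>set S. u \<noteq> r \<longrightarrow> tl u @ [p u] \<noteq> v)) S of
        None \<Rightarrow> []
      | Some f \<Rightarrow> f # prune_order r p (remove1 f S))"
  by pat_completeness auto
termination
  by (relation "measure (\<lambda>(r, p, S). length S)")
     (auto simp: find_Some_iff length_remove1 intro!: diff_less)

declare prune_order.simps [simp del]

text \<open>
  For a tree \<open>(r, p)\<close> in \<open>D (Suc m)\<close> and a vertex \<open>v\<close> of \<open>D m\<close>, the list \<open>exits r p m v\<close> records
  the parents chosen by the edges of \<open>D m\<close> that enter \<open>v\<close>, in the order of their deletion. The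
  root \<open>r\<close>, an edge into \<open>tl r\<close>, is never deleted, so the list has one entry if \<open>v = tl r\<close> and two
  entries otherwise. The last entries at the vertices \<open>v \<noteq> tl r\<close> form a spanning tree of \<open>D m\<close>
  with root \<open>tl r\<close>; the first entries, one for each vertex, are \<open>2 ^ m\<close> further bits.
\<close>

definition exits :: "bool list \<Rightarrow> (bool list \<Rightarrow> bool) \<Rightarrow> nat \<Rightarrow> bool list \<Rightarrow> bool list" where
  "exits r p m v = map p (filter (\<lambda>f. tl f = v) (prune_order r p (words (Suc m))))"

fun tree_code :: "nat \<Rightarrow> bool list \<Rightarrow> (bool list \<Rightarrow> bool) \<Rightarrow> bool list" where
  "tree_code 0 r p = []"
| "tree_code (Suc m) r p =
     map (\<lambda>v. hd (exits r p m v)) (words m) @ tree_code m (tl r) (\<lambda>v. last (exits r p m v))"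

text \<open>
  A de Bruijn sequence of degree \<open>n\<close> is an Eulerian circuit of \<open>D (n - 1)\<close> with start vertex
  \<open>take (n - 1) b\<close>. The bits that follow the last visits to the other vertices form the tree
  of the BEST theorem, whose root is the start vertex.
\<close>

definition last_exit :: "nat \<Rightarrow> bool list \<Rightarrow> bool list \<Rightarrow> bool" where
  "last_exit n b v =
     b ! ((last (filter (\<lambda>i. window b (n - 1) i = v) [0..<length b]) + (n - 1)) mod length b)"

text \<open>
  The first bit is the first exit from the start vertex. At every other vertex the first exit is
  the complement of the last one, so the tree and this bit determine the circuit.
\<close>

definition de_bruijn_code :: "nat \<Rightarrow> bool list \<Rightarrow> bool list" where
  "de_bruijn_code n b = b ! (n - 1) # tree_code (n - 1) (take (n - 1) b) (last_exit n b)"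

end

theory Submission
  imports Defs
begin

text \<open>
  Both layers of the code are decoded by replaying lists of exits.

  A tree in \<open>D (Suc m)\<close> is determined by the lists of exits at the vertices of \<open>D m\<close>: the parents
  that are still to be used are exactly the edges \<open>v @ [c]\<close> for the remaining exits \<open>c\<close> at \<open>v\<close>, so
  the smallest leaf is the first surviving edge not of this form, and its parent is given by the
  first remaining exit at its head. Replaying arbitrary lists of the right lengths succeeds as soon
  as the last exits form a tree, which gives an induction on \<open>m\<close>.

  An Eulerian circuit is likewise determined by its lists of exits, each of which is a permutation
  of the two bits. As in the BEST theorem, following such lists from the root uses every edge
  provided that the last exits form a tree directed towards the root.
\<close>

subsection \<open>Arborescences given by a parent function\<close>

text \<open>The last clause is reachability of the root without paths: applied to the orbit of a
  vertex up to \<open>r\<close>, it says that iterating \<open>f\<close> arrives at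
  \<open>r\<close>.\<close>

definition arborescence :: "'a \<Rightarrow> ('a \<Rightarrow> 'a) \<Rightarrow> 'a set \<Rightarrow> bool" where
  "arborescence r f S \<longleftrightarrow> r \<in> S \<and> (\<forall>u\<in>S - {r}. f u \<in> S) \<and>
     (\<forall>X\<subseteq>S. X \<noteq> {} \<longrightarrow> (\<forall>u\<in>X - {r}. f u \<in> X) \<longrightarrow> r \<in> X)"

lemma arborescence_root: "arborescence r f S \<Longrightarrow> r \<in> S"
  by (simp add: arborescence_def)

lemma arborescence_closed: "arborescence r f S \<Longrightarrow> u \<in> S \<Longrightarrow> u \<noteq> r \<Longrightarrow> f u \<in> S"
  by (simp add: arborescence_def)

lemma arborescence_reaches_root:
  assumes "arborescence r f S" "X \<subseteq> S" "X \<noteq> {}" "\<And>u. u \<in> X \<Longrightarrow> u \<noteq> r \<Longrightarrow> f u \<in> X"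
  shows "r \<in> X"
  using assms unfolding arborescence_def by blast

lemma arborescence_singleton: "arborescence r f {r}"
  by (auto simp: arborescence_def)

text \<open>A nonempty parent-closed set without \<open>r\<close> meets \<open>S\<close>, since it
  contains \<open>f' v\<close> whenever it contains \<open>v\<close>; the intersection is closed
  under \<open>f\<close>. The disjunction covers a vertex that may already be present.\<close>

lemma arborescence_insert:
  assumes a: "arborescence r f S" and eq: "\<And>u. u \<in> S \<Longrightarrow> u \<noteq> r \<Longrightarrow> f' u = f u"
    and v: "v \<in> S \<or> f' v \<in> S"
  shows "arborescence r f' (insert v S)"
  unfolding arborescence_def
proof (intro conjI allI impI ballI)
  show "r \<in> insert v S" using arborescence_root[OF a] by simp
  fix u assume "u \<in> insert v S - {r}"
  then show "f' u \<in> insert v S" using v eq arborescence_closed[OF a, of u] by auto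
next
  fix X assume X: "X \<subseteq> insert v S" "X \<noteq> {}" and cl: "\<forall>u\<in>X - {r}. f' u \<in> X"
  show "r \<in> X"
  proof (rule ccontr)
    assume "r \<notin> X"
    have "r \<in> X \<inter> S"
    proof (rule arborescence_reaches_root[OF a])
      show "X \<inter> S \<noteq> {}" using X v cl \<open>r \<notin> X\<close> by blast
      fix u assume u: "u \<in> X \<inter> S" "u \<noteq> r"
      then have "f' u \<in> X" using cl by blast
      then show "f u \<in> X \<inter> S" using u eq[of u] arborescence_closed[OF a, of u] by auto
    qed simp
    then show False using \<open>r \<notin> X\<close> by simp
  qed
qed

lemma arborescence_cong:
  assumes "arborescence r f S" "\<And>u. u \<in> S \<Longrightarrow> u \<noteq> r \<Longrightarrow> f' u = f u"
  shows "arborescence r f' S"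
  using arborescence_insert[of r f S f' r] assms arborescence_root[OF assms(1)]
  by (simp add: insert_absorb)

lemma arborescence_remove_leaf:
  assumes a: "arborescence r f S" and v: "v \<noteq> r" "v \<notin> f ` (S - {r})"
  shows "arborescence r f (S - {v})"
  unfolding arborescence_def
proof (intro conjI allI impI ballI)
  show "r \<in> S - {v}" using arborescence_root[OF a] v by simp
  fix u assume "u \<in> S - {v} - {r}"
  then show "f u \<in> S - {v}" using v arborescence_closed[OF a, of u] by auto
next
  fix X assume "X \<subseteq> S - {v}" "X \<noteq> {}" and cl: "\<forall>u\<in>X - {r}. f u \<in> X"
  then show "r \<in> X" using arborescence_reaches_root[OF a, of X] by blast
qed

text \<open>Otherwise the nonempty set \<open>S - {r}\<close> would be closed under parents without
  containing \<open>r\<close>.\<close>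

lemma arborescence_root_is_parent:
  assumes a: "arborescence r f S" and ne: "S \<noteq> {r}"
  shows "r \<in> f ` (S - {r})"
proof (rule ccontr)
  assume n: "r \<notin> f ` (S - {r})"
  have "r \<in> S - {r}"
  proof (rule arborescence_reaches_root[OF a])
    show "S - {r} \<noteq> {}" using ne arborescence_root[OF a] by blast
    show "f u \<in> S - {r}" if "u \<in> S - {r}" "u \<noteq> r" for u
      using that n arborescence_closed[OF a, of u] by force
  qed blast
  then show False by simp
qed

text \<open>Counting: were every vertex a parent, the smaller set \<open>S - {r}\<close> would be
  mapped onto all of \<open>S\<close>.\<close>

lemma arborescence_leaf_exists:
  assumes a: "arborescence r f S" and fin: "finite S" and ne: "S \<noteq> {r}"
  shows "\<exists>v\<in>S. v \<notin> f ` (S - {r})"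
proof (rule ccontr)
  assume "\<not> ?thesis"
  then have "S \<subseteq> f ` (S - {r})" by blast
  then have "card S \<le> card (S - {r})"
    using fin by (meson finite_Diff surj_card_le)
  then show False using fin arborescence_root[OF a]
    by (metis card_Diff1_less not_le)
qed

subsection \<open>Pruning and exits\<close>

abbreviation step :: "(bool list \<Rightarrow> bool) \<Rightarrow> bool list \<Rightarrow> bool list" where
  "step p v \<equiv> tl v @ [p v]"

text \<open>\<open>exits\<close> relativised to a list \<open>S\<close> of surviving vertices, so
  that inductions can follow single deletions.\<close>

definition exits_in :: "bool list \<Rightarrow> (bool list \<Rightarrow> bool) \<Rightarrow> bool list list \<Rightarrow> bool list \<Rightarrow> bool list" where
  "exits_in r p S v = map p (filter (\<lambda>f. tl f = v) (prune_order r p S))"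

text \<open>While other vertices remain, the root is itself a parent, so the test in
  \<open>prune_order\<close> reduces to not being a parent. The next leaf thus depends on
  \<open>r\<close> and \<open>p\<close> only through the set of parents.\<close>

lemma prune_order_Cons:
  assumes a: "arborescence r (step p) (set S)" and ne: "set S \<noteq> {r}"
  obtains f where "find (\<lambda>v. v \<notin> step p ` (set S - {r})) S = Some f"
    "f \<in> set S" "f \<noteq> r" "f \<notin> step p ` (set S - {r})"
    "prune_order r p S = f # prune_order r p (remove1 f S)"
proof -
  have r: "r \<in> step p ` (set S - {r})" by (rule arborescence_root_is_parent[OF a ne])
  have eq: "(\<lambda>v. v \<noteq> r \<and> (\<forall>u\<in>set S. u \<noteq> r \<longrightarrow> step p u \<noteq> v)) = (\<lambda>v. v \<notin> step p ` (set S - {r}))"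
    using r by (intro ext) blast
  obtain f where f: "find (\<lambda>v. v \<notin> step p ` (set S - {r})) S = Some f"
    using arborescence_leaf_exists[OF a _ ne] by (metis (no_types, lifting) List.finite_set find_None_iff not_Some_eq)
  then have m: "f \<in> set S" "f \<notin> step p ` (set S - {r})"
    by (auto simp: find_Some_iff)
  show thesis
  proof (rule that[OF f m(1) _ m(2)])
    show "f \<noteq> r" using m r by blast
    show "prune_order r p S = f # prune_order r p (remove1 f S)"
      by (subst prune_order.simps) (simp only: eq f option.case)
  qed
qed

lemma prune_order_singleton: "prune_order r p [r] = []"
  by (subst prune_order.simps) simp

lemma distinct_singleton_list: "distinct xs \<Longrightarrow> set xs = {x} \<Longrightarrow> xs = [x]"
  by (cases xs; cases "tl xs") auto

lemma length_remove1_less: "x \<in> set xs \<Longrightarrow> length (remove1 x xs) < length xs"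
  by (induction xs) auto

lemma prune_order_induct [consumes 2, case_names root leaf]:
  assumes "distinct S" "arborescence r (step p) (set S)"
    and root: "P [r]"
    and leaf: "\<And>S f. distinct S \<Longrightarrow> arborescence r (step p) (set S) \<Longrightarrow> set S \<noteq> {r} \<Longrightarrow>
      find (\<lambda>v. v \<notin> step p ` (set S - {r})) S = Some f \<Longrightarrow>
      f \<in> set S \<Longrightarrow> f \<noteq> r \<Longrightarrow> f \<notin> step p ` (set S - {r}) \<Longrightarrow>
      prune_order r p S = f # prune_order r p (remove1 f S) \<Longrightarrow>
      arborescence r (step p) (set (remove1 f S)) \<Longrightarrow>
      P (remove1 f S) \<Longrightarrow> P S"
  shows "P S"
  using assms(1,2)
proof (induction "length S" arbitrary: S rule: less_induct)
  case less
  show ?case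
  proof (cases "set S = {r}")
    case True
    then have "S = [r]" using less.prems(1)
      by (intro distinct_singleton_list) (use True in auto)
    then show ?thesis using root by simp
  next
    case False
    obtain f where f: "find (\<lambda>v. v \<notin> step p ` (set S - {r})) S = Some f"
      "f \<in> set S" "f \<noteq> r" "f \<notin> step p ` (set S - {r})"
      "prune_order r p S = f # prune_order r p (remove1 f S)"
      using prune_order_Cons[OF less.prems(2) False] .
    have a: "arborescence r (step p) (set (remove1 f S))"
      using arborescence_remove_leaf[OF less.prems(2) f(3,4)] less.prems(1) by (simp add: set_remove1_eq)
    have "length (remove1 f S) < length S"
      using f(2) by (rule length_remove1_less)
    then have "P (remove1 f S)"
      using less.hyps[of "remove1 f S"] a less.prems(1) by simp
    then show ?thesis by (rule leaf[OF less.prems False f a])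
  qed
qed

lemma set_prune_order:
  assumes "distinct S" "arborescence r (step p) (set S)"
  shows "set (prune_order r p S) = set S - {r}" and "distinct (prune_order r p S)"
proof -
  have "set (prune_order r p S) = set S - {r} \<and> distinct (prune_order r p S)"
    using assms by (induction rule: prune_order_induct) (auto simp: prune_order_singleton)
  then show "set (prune_order r p S) = set S - {r}" "distinct (prune_order r p S)" by auto
qed

lemma set_prune_order_subset: "set (prune_order r p S) \<subseteq> set S - {r}"
proof (induction r p S rule: prune_order.induct)
  case (1 r p S)
  show ?case
  proof (cases "find (\<lambda>v. v \<noteq> r \<and> (\<forall>u\<in>set S. u \<noteq> r \<longrightarrow> step p u \<noteq> v)) S")
    case None
    then have "prune_order r p S = []"
      by (subst prune_order.simps) (simp only: None option.case)
    then show ?thesis by simp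
  next
    case (Some f)
    then have "prune_order r p S = f # prune_order r p (remove1 f S)"
      by (subst prune_order.simps) (simp only: Some option.case)
    moreover have "f \<in> set S" "f \<noteq> r" using Some by (auto simp: find_Some_iff)
    moreover have "set (remove1 f S) \<subseteq> set S" by (rule set_remove1_subset)
    ultimately show ?thesis using "1"[OF Some] by auto
  qed
qed

lemma prune_order_cong:
  assumes "\<And>u. u \<in> set S \<Longrightarrow> u \<noteq> r \<Longrightarrow> p u = p' u"
  shows "prune_order r p S = prune_order r p' S"
  using assms
proof (induction r p S rule: prune_order.induct)
  case (1 r p S)
  have eq: "(\<lambda>v. v \<noteq> r \<and> (\<forall>u\<in>set S. u \<noteq> r \<longrightarrow> step p u \<noteq> v)) =
      (\<lambda>v. v \<noteq> r \<and> (\<forall>u\<in>set S. u \<noteq> r \<longrightarrow> step p' u \<noteq> v))"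
    using "1.prems" by auto
  have IH: "prune_order r p (remove1 f S) = prune_order r p' (remove1 f S)"
    if "find (\<lambda>v. v \<noteq> r \<and> (\<forall>u\<in>set S. u \<noteq> r \<longrightarrow> step p u \<noteq> v)) S = Some f" for f
    by (rule "1.IH"[OF that]) (meson "1.prems" notin_set_remove1)
  show ?case
    by (subst (1 2) prune_order.simps) (use IH in \<open>simp add: eq split: option.split\<close>)
qed

lemma exits_in_cong:
  assumes "\<And>u. u \<in> set S \<Longrightarrow> u \<noteq> r \<Longrightarrow> p u = p' u"
  shows "exits_in r p S v = exits_in r p' S v"
  unfolding exits_in_def prune_order_cong[of S r p p', OF assms, simplified]
  using set_prune_order_subset[of r p' S] assms by (intro map_cong) auto

section \<open>Replaying the exits of a tree\<close>

lemma exits_in_Cons: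
  assumes "prune_order r p S = f # prune_order r p (remove1 f S)"
  shows "exits_in r p S v = (if tl f = v then [p f] else []) @ exits_in r p (remove1 f S) v"
  unfolding exits_in_def by (subst assms) simp

text \<open>The parent \<open>tl f @ [p f]\<close> of a deleted \<open>f\<close> is the exit
  \<open>p f\<close> recorded at \<open>tl f\<close>, so the set of parents can be read off the
  exits without knowing the tree.\<close>

lemma image_step_eq_exits_in:
  assumes "distinct S" "arborescence r (step p) (set S)"
  shows "step p ` (set S - {r}) = {w @ [c] |w c. c \<in> set (exits_in r p S w)}"
  using set_prune_order(1)[OF assms] by (auto simp: exits_in_def)

text \<open>Equal exits give equal sets of parents, hence the same first leaf \<open>f\<close>; its
  parent bit is the first exit at \<open>tl f\<close>. Deleting both repeats the situation until the
  sole survivor is the root.\<close>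

lemma exits_in_inj:
  assumes "distinct S" "arborescence r (step p) (set S)" "arborescence r' (step p') (set S)"
    and "\<And>v. exits_in r p S v = exits_in r' p' S v"
  shows "r = r' \<and> (\<forall>u\<in>set S - {r}. p u = p' u)"
  using assms
proof (induction rule: prune_order_induct)
  case root
  then show ?case using arborescence_root by fastforce
next
  case (leaf S f)
  have ne: "set S \<noteq> {r'}" using leaf arborescence_root by fastforce
  obtain f' where f': "find (\<lambda>v. v \<notin> step p' ` (set S - {r'})) S = Some f'"
      "f' \<in> set S" "f' \<noteq> r'" "f' \<notin> step p' ` (set S - {r'})"
      "prune_order r' p' S = f' # prune_order r' p' (remove1 f' S)"
    using prune_order_Cons[OF leaf.prems(1) ne] .
  have "step p ` (set S - {r}) = step p' ` (set S - {r'})"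
    using image_step_eq_exits_in[of S r p] image_step_eq_exits_in[of S r' p'] leaf by simp
  then have ff: "f' = f" using f'(1) leaf.hyps(4) by simp
  have ex: "(if tl f = v then [p f] else []) @ exits_in r p (remove1 f S) v =
      (if tl f = v then [p' f] else []) @ exits_in r' p' (remove1 f S) v" for v
    using exits_in_Cons[OF leaf.hyps(8), of v] exits_in_Cons[OF f'(5)[unfolded ff], of v]
      leaf.prems(2)[of v] by metis
  have pf: "p f = p' f" using ex[of "tl f"] by simp
  have "arborescence r' (step p') (set (remove1 f S))"
    using arborescence_remove_leaf[OF leaf.prems(1) f'(3,4)] ff leaf.hyps(1) by (simp add: set_remove1_eq)
  moreover have "exits_in r p (remove1 f S) v = exits_in r' p' (remove1 f S) v" for v
    using ex[of v] by (simp split: if_splits)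
  ultimately have "r = r' \<and> (\<forall>u\<in>set (remove1 f S) - {r}. p u = p' u)" by (rule leaf.IH)
  then show ?case using pf leaf.hyps(1) by (auto simp: set_remove1_eq)
qed

text \<open>Induction that puts \<open>f\<close> back. Its bit goes to the front of the list at
  \<open>tl f\<close>, so last exits at vertices other than \<open>tl r\<close> entered by survivors
  stay the same; a vertex \<open>tl f\<close> entered by no survivor becomes a new leaf below
  \<open>tl (step p f)\<close>.\<close>

lemma last_exits_arborescence:
  assumes "distinct S" "arborescence r (step p) (set S)" "\<And>f. f \<in> set S \<Longrightarrow> length f = Suc m"
  shows "arborescence (tl r) (step (\<lambda>v. last (exits_in r p S v))) (tl ` set S)"
  using assms
proof (induction rule: prune_order_induct)
  case root
  then show ?case by (simp add: arborescence_singleton)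
next
  case (leaf S f)
  let ?S = "remove1 f S"
  have S: "set S = insert f (set ?S)" "distinct ?S" using leaf by (auto simp: set_remove1_eq)
  have IH: "arborescence (tl r) (step (\<lambda>v. last (exits_in r p ?S v))) (tl ` set ?S)"
    using leaf.IH leaf.prems S(1) by simp
  note ex = exits_in_Cons[OF leaf.hyps(8)]
  \<comment> \<open>A surviving edge into \<open>v \<noteq> tl r\<close> is not the root, so it is
    deleted later and leaves an exit behind the prepended \<open>p f\<close>.\<close>
  have ne: "exits_in r p ?S v \<noteq> []" if v: "v \<in> tl ` set ?S" "v \<noteq> tl r" for v
  proof -
    obtain g where g: "g \<in> set ?S" "tl g = v" using v by auto
    then have "g \<in> set (prune_order r p ?S)"
      using set_prune_order(1)[OF S(2) leaf.hyps(9)] v by auto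
    then show ?thesis using g unfolding exits_in_def by (auto simp: filter_empty_conv)
  qed
  have "arborescence (tl r) (step (\<lambda>v. last (exits_in r p S v))) (insert (tl f) (tl ` set ?S))"
  proof (rule arborescence_insert[OF IH])
    show "step (\<lambda>v. last (exits_in r p S v)) u = step (\<lambda>v. last (exits_in r p ?S v)) u"
      if "u \<in> tl ` set ?S" "u \<noteq> tl r" for u
      using ne[OF that] by (simp add: ex)
    show "tl f \<in> tl ` set ?S \<or> step (\<lambda>v. last (exits_in r p S v)) (tl f) \<in> tl ` set ?S"
    proof (cases "tl f \<in> tl ` set ?S")
      case False
      have "r \<in> set ?S" using arborescence_root[OF leaf.hyps(9)] .
      then have "tl f \<noteq> tl r" using False by auto
      moreover have "length f = Suc m" "length r = Suc m"
        using leaf.prems leaf.hyps(5) arborescence_root[OF leaf.hyps(2)] by auto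
      \<comment> \<open>\<open>tl\<close> commutes with appending a bit only on nonempty lists. For
        \<open>m = 0\<close> this case is void, as then \<open>tl f = tl r\<close>.\<close>
      ultimately have "tl f \<noteq> []" by (cases f; cases r) auto
      have "exits_in r p ?S (tl f) = []"
        using False set_prune_order_subset[of r p ?S] unfolding exits_in_def
        by (auto simp: filter_empty_conv) (metis DiffD1 imageI subsetD)
      then have "step (\<lambda>v. last (exits_in r p S v)) (tl f) = tl (step p f)"
        using \<open>tl f \<noteq> []\<close> by (simp add: ex)
      moreover have "step p f \<in> set ?S"
      proof -
        have "step p f \<in> step p ` (set S - {r})" using leaf.hyps(5,6) by blast
        then have "step p f \<noteq> f" using leaf.hyps(7) by metis
        then show ?thesis
          using arborescence_closed[OF leaf.hyps(2) leaf.hyps(5,6)] leaf.hyps(1) by simp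
      qed
      ultimately show ?thesis by auto
    qed simp
  qed
  then show ?case using S(1) by simp
qed

lemma finite_words: "finite {v :: bool list. length v = m \<and> P v}"
  by (rule finite_subset[OF _ finite_lists_length_eq[of UNIV m]]) auto

text \<open>
  If the chosen leaf had no exit left at its head, that head would be \<open>s\<close>, and following last exits
  from any other surviving vertex would use the leaf as a parent.
\<close>

lemma exits_in_surj:
  assumes "arborescence s (step q) {v. length v = m}"
    and "distinct S" "\<And>f. f \<in> set S \<Longrightarrow> length f = Suc m"
    and "\<And>v. length (E v) + (if v = s then 1 else 0) = card {f \<in> set S. tl f = v}"
    and "\<And>v c. c \<in> set (E v) \<Longrightarrow> v @ [c] \<in> set S"
    and "\<And>v. E v \<noteq> [] \<Longrightarrow> v \<noteq> s \<Longrightarrow> last (E v) = q v"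
  shows "\<exists>r p. arborescence r (step p) (set S) \<and> tl r = s \<and> (\<forall>v. exits_in r p S v = E v)"
  using assms(2-)
proof (induction "length S" arbitrary: S E rule: less_induct)
  case less
  note dS = less.prems(1) and len = less.prems(2) and cnt = less.prems(3)
    and mem = less.prems(4) and lst = less.prems(5)
  have entered: "w \<in> tl ` set S" if "card {f \<in> set S. tl f = w} \<noteq> 0" for w
  proof (rule ccontr)
    assume "w \<notin> tl ` set S"
    then have "{f \<in> set S. tl f = w} = {}" by auto
    then show False using that by (metis card.empty)
  qed
  have s: "s \<in> tl ` set S" by (rule entered) (simp flip: cnt)
  have Etl: "w \<in> tl ` set S" if "E w \<noteq> []" for w
    by (rule entered) (use that in \<open>simp flip: cnt\<close>)
  have Elen: "length w = m" if "E w \<noteq> []" for w using Etl[OF that] len by auto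
  let ?Q = "{w @ [c] |w c. c \<in> set (E w)}"
  \<comment> \<open>Counting: because of the summand 1 at \<open>s\<close>, there is one exit fewer
    than surviving edges. So \<open>?Q\<close>, the set of parents still to be used, cannot cover
    \<open>S\<close>.\<close>
  have "\<exists>f\<in>set S. f \<notin> ?Q"
  proof (rule ccontr)
    assume "\<not> ?thesis"
    then have "set S \<subseteq> ?Q" by blast
    also have "?Q \<subseteq> (\<Union>w\<in>tl ` set S. (\<lambda>c. w @ [c]) ` set (E w))"
    proof
      fix x assume "x \<in> ?Q"
      then obtain w c where x: "x = w @ [c]" "c \<in> set (E w)" by blast
      then have "w \<in> tl ` set S" using Etl by (metis empty_iff list.set(1))
      then show "x \<in> (\<Union>w\<in>tl ` set S. (\<lambda>c. w @ [c]) ` set (E w))" using x by blast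
    qed
    finally have "card (set S) \<le> card (\<Union>w\<in>tl ` set S. (\<lambda>c. w @ [c]) ` set (E w))"
      by (intro card_mono) auto
    also have "\<dots> \<le> (\<Sum>w\<in>tl ` set S. card ((\<lambda>c. w @ [c]) ` set (E w)))"
      by (rule card_UN_le) simp
    also have "\<dots> \<le> (\<Sum>w\<in>tl ` set S. length (E w))"
      by (intro sum_mono) (meson List.finite_set card_image_le card_length le_trans)
    also have "\<dots> < (\<Sum>w\<in>tl ` set S. length (E w) + (if w = s then 1 else 0))"
      using s by (simp add: sum.distrib)
    also have "\<dots> = (\<Sum>w\<in>tl ` set S. card {f \<in> set S. tl f = w})" using cnt by simp
    also have "\<dots> = card (set S)"
      using sum.image_gen[of "set S" "\<lambda>_. 1::nat" tl] by simp
    finally show False by simp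
  qed
  then obtain f where f: "find (\<lambda>v. v \<notin> ?Q) S = Some f"
    by (metis (no_types, lifting) find_None_iff not_Some_eq)
  then have fS: "f \<in> set S" and fQ: "f \<notin> ?Q" by (auto simp: find_Some_iff)
  show ?case
  proof (cases "set S = {f}")
    case True
    then have S: "S = [f]" by (rule distinct_singleton_list[OF dS])
    have "tl f = s" using s True by auto
    moreover have "E v = []" for v
    proof -
      have "{g \<in> set S. tl g = v} = (if v = s then {f} else {})"
        using True \<open>tl f = s\<close> by auto
      then show ?thesis using cnt[of v] by (simp split: if_splits)
    qed
    ultimately show ?thesis using S
      by (intro exI[of _ f]) (simp add: arborescence_singleton exits_in_def prune_order_singleton)
  next
    case False
    have ne: "E (tl f) \<noteq> []"
    proof
      assume e: "E (tl f) = []"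
      have c1: "card {g \<in> set S. tl g = tl f} \<noteq> 0" using fS by auto
      then have fs: "tl f = s" using cnt[of "tl f"] e by (auto split: if_splits)
      then have "card {g \<in> set S. tl g = s} = 1" using cnt[of s] e by simp
      then obtain h where h: "{g \<in> set S. tl g = s} = {h}" by (rule card_1_singletonE)
      have uniq: "g = f" if "g \<in> set S" "tl g = s" for g
      proof -
        have "g \<in> {h}" "f \<in> {h}" unfolding h[symmetric] using that fs fS by auto
        then show ?thesis by simp
      qed
      have Ene: "E (tl g) \<noteq> []" if "g \<in> set S" "tl g \<noteq> s" for g
      proof -
        have "card {h \<in> set S. tl h = tl g} \<noteq> 0" using that by auto
        then show ?thesis using cnt[of "tl g"] that by auto
      qed
      \<comment> \<open>Closure under last exits: \<open>v @ [q v]\<close> lies in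
        \<open>?Q\<close>, so it is not \<open>f\<close>, the only surviving edge into
        \<open>s\<close>; hence its head has exits left by \<open>Ene\<close>. Then \<open>s\<close>
        has one too, against \<open>E (tl f) = []\<close>.\<close>
      have "s \<in> {v. E v \<noteq> []}"
      proof (rule arborescence_reaches_root[OF assms(1)])
        show "{v. E v \<noteq> []} \<subseteq> {v. length v = m}" using Elen by blast
        obtain g where "g \<in> set S" "g \<noteq> f" using False fS by auto
        then show "{v. E v \<noteq> []} \<noteq> {}" using uniq Ene by blast
        fix v assume v: "v \<in> {v. E v \<noteq> []}" "v \<noteq> s"
        then have "length v = m" "length s = m"
          using Elen arborescence_root[OF assms(1)] by auto
        then have vne: "v \<noteq> []" using v by auto
        have c: "q v \<in> set (E v)" using lst[of v] last_in_set[of "E v"] v by simp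
        then have "v @ [q v] \<in> set S" by (rule mem)
        moreover have "v @ [q v] \<noteq> f" using c fQ by blast
        ultimately show "step q v \<in> {v. E v \<noteq> []}"
          using uniq[of "v @ [q v]"] Ene[of "v @ [q v]"] vne by auto
      qed
      then show False using e fs by simp
    qed
    define c E' where "c = hd (E (tl f))" and "E' = E(tl f := tl (E (tl f)))"
    have Ef: "E (tl f) = c # E' (tl f)" using ne by (simp add: c_def E'_def)
    have EE: "E v = (if tl f = v then [c] else []) @ E' v" for v using Ef by (simp add: E'_def)
    let ?S = "remove1 f S"
    have S: "set ?S = set S - {f}" "distinct ?S" using dS by auto
    have c: "c \<in> set (E (tl f))" using Ef by simp
    have "tl f @ [c] \<in> ?Q" using c by blast
    then have cf: "tl f @ [c] \<noteq> f" "tl f @ [c] \<in> set S" using fQ mem[OF c] by metis+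
    have "\<exists>r p. arborescence r (step p) (set ?S) \<and> tl r = s \<and> (\<forall>v. exits_in r p ?S v = E' v)"
    proof (rule less.hyps)
      show "length ?S < length S" using fS by (rule length_remove1_less)
      show "distinct ?S" by fact
      show "length g = Suc m" if "g \<in> set ?S" for g using that S len by simp
      show "v @ [d] \<in> set ?S" if "d \<in> set (E' v)" for v d
      proof -
        have "d \<in> set (E v)" using that EE[of v] by simp
        then show ?thesis using S mem[of d v] fQ by auto
      qed
      show "last (E' v) = q v" if "E' v \<noteq> []" "v \<noteq> s" for v
        using lst[of v] that EE[of v] by auto
      show "length (E' v) + (if v = s then 1 else 0) = card {g \<in> set ?S. tl g = v}" for v
      proof (cases "tl f = v")
        case True
        have "{g \<in> set ?S. tl g = v} = {g \<in> set S. tl g = v} - {f}" using S by auto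
        then have "card {g \<in> set ?S. tl g = v} = card {g \<in> set S. tl g = v} - 1"
          using fS True by (simp add: card_Diff_singleton)
        then show ?thesis using cnt[of v] EE[of v] True by simp
      next
        case False
        then have "{g \<in> set ?S. tl g = v} = {g \<in> set S. tl g = v}" using S by auto
        then show ?thesis using cnt[of v] EE[of v] False by simp
      qed
    qed
    then obtain r p where rp: "arborescence r (step p) (set ?S)" "tl r = s"
        "\<And>v. exits_in r p ?S v = E' v" by blast
    \<comment> \<open>\<open>f\<close> is hung as a leaf from \<open>tl f @ [c]\<close>, which
      survives: it is in \<open>S\<close>, and it differs from \<open>f\<close> because it lies in
      \<open>?Q\<close>.\<close>
    define p' where "p' = p(f := c)"
    have S2: "insert f (set ?S) = set S" using S fS by auto
    have arb: "arborescence r (step p') (set S)"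
      unfolding S2[symmetric]
      by (rule arborescence_insert[OF rp(1)]) (use S cf in \<open>auto simp: p'_def\<close>)
    have r: "r \<in> set ?S" "r \<noteq> f" using arborescence_root[OF rp(1)] S by auto
    have "set S \<noteq> {r}" using r(2) fS by (metis singletonD)
    \<comment> \<open>With \<open>?Q\<close> as its set of parents, the rebuilt tree is pruned
      starting with the same leaf \<open>f\<close>, which reproduces \<open>E\<close>.\<close>
    have Q: "step p' ` (set S - {r}) = ?Q"
    proof -
      have "set S - {r} = insert f (set ?S - {r})" using S2 r by blast
      moreover have "step p' ` (set ?S - {r}) = step p ` (set ?S - {r})"
        by (rule image_cong) (use S in \<open>auto simp: p'_def\<close>)
      ultimately have "step p' ` (set S - {r}) = insert (tl f @ [c]) (step p ` (set ?S - {r}))"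
        by (simp add: p'_def)
      also have "\<dots> = insert (tl f @ [c]) {w @ [c] |w c. c \<in> set (E' w)}"
        using image_step_eq_exits_in[OF S(2) rp(1)] rp(3) by simp
      also have "\<dots> = ?Q" unfolding EE by (auto split: if_splits)
      finally show ?thesis .
    qed
    obtain g where g: "find (\<lambda>v. v \<notin> step p' ` (set S - {r})) S = Some g"
        "prune_order r p' S = g # prune_order r p' (remove1 g S)"
      by (rule prune_order_Cons[OF arb \<open>set S \<noteq> {r}\<close>]) (rule that)
    have "g = f" using g(1) f unfolding Q by simp
    have "exits_in r p' S v = E v" for v
    proof -
      have "exits_in r p' ?S v = exits_in r p ?S v"
        by (rule exits_in_cong) (use S in \<open>auto simp: p'_def\<close>)
      then show ?thesis
        using exits_in_Cons[OF g(2), of v] \<open>g = f\<close> rp(3)[of v] EE[of v] by (simp add: p'_def)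
    qed
    then show ?thesis using arb rp(2) by blast
  qed
qed

subsection \<open>The tree code\<close>

abbreviation tree :: "nat \<Rightarrow> bool list \<Rightarrow> (bool list \<Rightarrow> bool) \<Rightarrow> bool" where
  "tree m r p \<equiv> arborescence r (step p) {v. length v = m}"

lemma set_words: "set (words m) = {v. length v = m}"
  by (induction m) (auto simp: length_Suc_conv)

lemma distinct_words: "distinct (words m)"
  by (induction m) (auto simp: distinct_map)

lemma length_words: "length (words m) = 2 ^ m"
  by (induction m) auto

lemma exits_eq: "exits r p m = exits_in r p (words (Suc m))"
  unfolding exits_def exits_in_def by (rule refl)

lemma entering_eq:
  assumes "length v = m"
  shows "{f :: bool list. length f = Suc m \<and> tl f = v} = {False # v, True # v}"
proof (rule set_eqI)
  fix f :: "bool list"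
  show "f \<in> {f. length f = Suc m \<and> tl f = v} \<longleftrightarrow> f \<in> {False # v, True # v}"
    using assms by (cases f; cases "hd f") auto
qed

text \<open>Only the edges \<open>False # v\<close> and \<open>True # v\<close> enter
  \<open>v\<close>; all edges but the root are deleted, and the root enters
  \<open>tl r\<close>.\<close>

lemma length_exits:
  assumes t: "tree (Suc m) r p" and v: "length v = m"
  shows "length (exits r p m v) = (if v = tl r then 1 else 2)"
proof -
  let ?L = "prune_order r p (words (Suc m))"
  have L: "set ?L = {v. length v = Suc m} - {r}" "distinct ?L"
    using set_prune_order[of "words (Suc m)" r p] t
    by (auto simp only: distinct_words set_words)
  have "length (exits r p m v) = length (filter (\<lambda>f. tl f = v) ?L)"
    unfolding exits_def by (rule length_map)
  also have "\<dots> = card (set (filter (\<lambda>f. tl f = v) ?L))"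
    using distinct_card[OF distinct_filter[OF L(2)]] by simp
  also have "set (filter (\<lambda>f. tl f = v) ?L) = {f. length f = Suc m \<and> tl f = v} - {r}"
    using L(1) by auto
  also have "\<dots> = {False # v, True # v} - {r}" using entering_eq[OF v] by simp
  also have "card \<dots> = (if v = tl r then 1 else 2)"
  proof -
    have "length r = Suc m" using arborescence_root[OF t] by simp
    then obtain a w where "r = a # w" by (auto simp: length_Suc_conv)
    then show ?thesis by (cases a) (auto simp: card_Diff_singleton_if)
  qed
  finally show ?thesis .
qed

lemma tree_last_exit:
  assumes t: "tree (Suc m) r p"
  shows "tree m (tl r) (\<lambda>v. last (exits r p m v))"
proof -
  have "arborescence (tl r) (step (\<lambda>v. last (exits r p m v))) (tl ` set (words (Suc m)))"
    unfolding exits_eq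
  proof (rule last_exits_arborescence[where m = m])
    show "distinct (words (Suc m))" by (rule distinct_words)
    show "arborescence r (step p) (set (words (Suc m)))" using t by (simp only: set_words)
    show "length f = Suc m" if "f \<in> set (words (Suc m))" for f
      using that by (simp only: set_words mem_Collect_eq)
  qed
  moreover have "tl ` set (words (Suc m)) = {v. length v = m}"
    unfolding set_words by (force simp: image_iff length_Suc_conv)
  ultimately show ?thesis by simp
qed

section \<open>Bijectivity of the tree code\<close>

lemma tree_code_cong:
  assumes "\<And>u. length u = m \<Longrightarrow> u \<noteq> r \<Longrightarrow> p u = p' u"
  shows "tree_code m r p = tree_code m r p'"
proof (cases m)
  case (Suc k)
  have "exits r p k v = exits r p' k v" for v
    unfolding exits_eq
    by (rule exits_in_cong) (use assms Suc in \<open>simp only: set_words mem_Collect_eq\<close>)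
  then show ?thesis using Suc by simp
qed simp

text \<open>Each level \<open>k < m\<close> contributes \<open>2 ^ k\<close> bits, a geometric sum
  one short of \<open>2 ^ m\<close>; \<open>de_bruijn_code\<close> supplies the missing bit as the
  first exit.\<close>

lemma length_tree_code: "Suc (length (tree_code m r p)) = 2 ^ m"
  by (induction m arbitrary: r p) (simp_all add: length_words flip: add_Suc_right)

lemma length_2_eqI:
  assumes "length xs = 2" "length ys = 2" "hd xs = hd ys" "last xs = last ys"
  shows "xs = ys"
  using assms by (auto simp: numeral_2_eq_2 length_Suc_conv)

text \<open>By induction the tail of the code fixes the tree of last exits, and the leading bits are
  the first exits. Lists of one or two entries are determined by their ends, and
  \<open>exits_in_inj\<close> recovers the tree.\<close>

lemma tree_code_inj:
  assumes "tree m r p" "tree m r' p'" "tree_code m r p = tree_code m r' p'"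
  shows "r = r' \<and> (\<forall>u. length u = m \<longrightarrow> u \<noteq> r \<longrightarrow> p u = p' u)"
  using assms
proof (induction m arbitrary: r p r' p')
  case 0
  then show ?case using arborescence_root[OF 0(1)] arborescence_root[OF 0(2)] by auto
next
  case (Suc m)
  have hd: "hd (exits r p m v) = hd (exits r' p' m v)" if "length v = m" for v
    using Suc.prems(3) that by (simp add: set_words)
  have "tree_code m (tl r) (\<lambda>v. last (exits r p m v)) = tree_code m (tl r') (\<lambda>v. last (exits r' p' m v))"
    using Suc.prems(3) by simp
  from Suc.IH[OF tree_last_exit[OF Suc.prems(1)] tree_last_exit[OF Suc.prems(2)] this]
  have tl: "tl r = tl r'" and last: "\<And>v. length v = m \<Longrightarrow> v \<noteq> tl r \<Longrightarrow>
      last (exits r p m v) = last (exits r' p' m v)" by auto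
  have eq: "exits r p m v = exits r' p' m v" if v: "length v = m" for v
  proof (cases "v = tl r")
    \<comment> \<open>The induction hypothesis gives no last exit at \<open>tl r\<close>, but the
      only entry there is also the first exit.\<close>
    case True
    then have "length (exits r p m v) = 1" "length (exits r' p' m v) = 1"
      using length_exits[OF Suc.prems(1) v] length_exits[OF Suc.prems(2) v] tl by auto
    then show ?thesis using hd[OF v] by (auto simp: length_Suc_conv)
  next
    case False
    then show ?thesis
      using length_exits[OF Suc.prems(1) v] length_exits[OF Suc.prems(2) v] tl hd[OF v] last[OF v]
      by (intro length_2_eqI) auto
  qed
  have outside: "exits r p m v = []" if "length v \<noteq> m" for r p v
    using set_prune_order_subset[of r p "words (Suc m)"] that unfolding exits_def
    by (auto simp: filter_empty_conv set_words)
  have "r = r' \<and> (\<forall>u\<in>set (words (Suc m)) - {r}. p u = p' u)"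
  proof (rule exits_in_inj)
    show "distinct (words (Suc m))" by (rule distinct_words)
    show "arborescence r (step p) (set (words (Suc m)))"
      "arborescence r' (step p') (set (words (Suc m)))"
      using Suc.prems by (simp_all only: set_words)
    show "exits_in r p (words (Suc m)) v = exits_in r' p' (words (Suc m)) v" for v
      unfolding exits_eq[symmetric] using eq[of v] outside[of v] by (cases "length v = m") simp_all
  qed
  then show ?case by (simp only: set_words) blast
qed

text \<open>For \<open>Suc m\<close>, the first \<open>2 ^ m\<close> bits prescribe the first exits,
  and the rest encodes a tree \<open>(t, q)\<close> one level down, which prescribes the last exits
  away from \<open>t\<close>. These lists are realised by \<open>exits_in_surj\<close>.\<close>

lemma tree_code_surj:
  assumes "Suc (length s) = 2 ^ m"
  shows "\<exists>r p. tree m r p \<and> tree_code m r p = s"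
  using assms
proof (induction m arbitrary: s)
  case 0
  have "{v :: bool list. length v = 0} = {[]}" by auto
  then show ?case using 0 by (auto simp: arborescence_singleton intro!: exI[of _ "[]"])
next
  case (Suc m)
  define a where "a = take (2 ^ m) s"
  define s' where "s' = drop (2 ^ m) s"
  have len: "length a = 2 ^ m" "Suc (length s') = 2 ^ m"
    using Suc.prems by (auto simp: a_def s'_def min_def)
  obtain t q where t: "tree m t q" "tree_code m t q = s'" using Suc.IH[OF len(2)] by blast
  define A where "A = the \<circ> map_of (zip (words m) a)"
  have A: "map A (words m) = a"
    using len(1) distinct_words[of m]
    by (intro nth_equalityI) (auto simp: A_def length_words map_of_zip_nth)
  define E where "E v = (if length v \<noteq> m then [] else if v = t then [A v] else [A v, q v])" for v
  have "\<exists>r p. arborescence r (step p) (set (words (Suc m))) \<and> tl r = t \<and>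
      (\<forall>v. exits_in r p (words (Suc m)) v = E v)"
  proof (rule exits_in_surj[OF t(1)])
    show "distinct (words (Suc m))" by (rule distinct_words)
    show "length f = Suc m" if "f \<in> set (words (Suc m))" for f
      using that by (simp only: set_words mem_Collect_eq)
    have lt: "length t = m" using arborescence_root[OF t(1)] by simp
    show "length (E v) + (if v = t then 1 else 0) = card {f \<in> set (words (Suc m)). tl f = v}" for v
    proof (cases "length v = m")
      case True
      then show ?thesis using entering_eq[OF True] by (simp only: set_words mem_Collect_eq) (simp add: E_def)
    next
      case False
      then have "{f \<in> set (words (Suc m)). tl f = v} = {}" by (auto simp: set_words)
      then have "card {f \<in> set (words (Suc m)). tl f = v} = 0" by (metis card.empty)
      then show ?thesis using False lt by (auto simp: E_def)
    qed
    show "v @ [c] \<in> set (words (Suc m))" if "c \<in> set (E v)" for v c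
      unfolding set_words using that by (auto simp: E_def split: if_splits)
    show "last (E v) = q v" if "E v \<noteq> []" "v \<noteq> t" for v
      using that by (auto simp: E_def split: if_splits)
  qed
  then obtain r p where rp: "tree (Suc m) r p" "tl r = t" "\<And>v. exits r p m v = E v"
    unfolding set_words exits_eq by blast
  \<comment> \<open>The last exit at \<open>t\<close> is \<open>A t\<close>, which need not be
    \<open>q t\<close>; the code does not depend on the value at the root.\<close>
  have "tree_code m (tl r) (\<lambda>v. last (exits r p m v)) = tree_code m t q"
    unfolding rp(2) by (rule tree_code_cong) (simp add: rp(3) E_def)
  moreover have "map (\<lambda>v. hd (exits r p m v)) (words m) = a"
    unfolding A[symmetric] by (rule map_cong) (auto simp: rp(3) E_def set_words)
  ultimately have "tree_code (Suc m) r p = s"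
    using t(2) by (simp add: a_def s'_def)
  then show ?case using rp(1) by blast
qed

subsection \<open>Walks and Eulerian circuits\<close>

text \<open>For nonempty \<open>u\<close> the walk ends at \<open>drop (length cs) (u @ cs)\<close>,
  the form used for its end vertex below.\<close>

fun walk_exits :: "bool list \<Rightarrow> bool list \<Rightarrow> bool list \<Rightarrow> bool list" where
  "walk_exits u [] v = []"
| "walk_exits u (c # cs) v = (if u = v then [c] else []) @ walk_exits (tl u @ [c]) cs v"

text \<open>Replay: the next bit is the first remaining exit at the current vertex
  \<open>u\<close>.\<close>

lemma walk_exits_inj:
  assumes "length cs = length cs'" "walk_exits u cs = walk_exits u cs'"
  shows "cs = cs'"
  using assms
proof (induction cs cs' arbitrary: u rule: list_induct2)
  case (Cons c cs c' cs')
  have eq: "(if u = v then [c] else []) @ walk_exits (tl u @ [c]) cs v =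
      (if u = v then [c'] else []) @ walk_exits (tl u @ [c']) cs' v" for v
    using fun_cong[OF Cons.prems, of v] by simp
  have c: "c = c'" using eq[of u] by simp
  have "walk_exits (tl u @ [c]) cs = walk_exits (tl u @ [c]) cs'"
    using eq c by (intro ext) simp
  then show ?case using c Cons.IH by blast
qed simp

lemma walk_exits_outside:
  assumes "length u = m" "0 < m" "length v \<noteq> m"
  shows "walk_exits u cs v = []"
  using assms by (induction cs arbitrary: u) auto

text \<open>Turns the recursion into positions: bit \<open>i\<close> is read at the window of
  \<open>u @ cs\<close> that starts at \<open>i\<close>. This is the link to the definition of
  \<open>last_exit\<close>.\<close>

lemma walk_exits_eq:
  assumes "length u = m" "0 < m"
  shows "walk_exits u cs v =
    map ((!) cs) (filter (\<lambda>i. take m (drop i (u @ cs)) = v) [0..<length cs])"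
  using assms(1)
proof (induction cs arbitrary: u)
  case (Cons c cs)
  have drop: "drop (Suc i) (u @ c # cs) = drop i ((tl u @ [c]) @ cs)" for i
    using Cons.prems assms(2) by (cases u) auto
  have "walk_exits (tl u @ [c]) cs v =
      map ((!) cs) (filter (\<lambda>i. take m (drop i ((tl u @ [c]) @ cs)) = v) [0..<length cs])"
    by (rule Cons.IH) (use Cons.prems assms(2) in simp)
  also have "\<dots> = map ((!) (c # cs))
      (filter (\<lambda>i. take m (drop i (u @ c # cs)) = v) (map Suc [0..<length cs]))"
    unfolding filter_map drop o_def by (simp add: o_def)
  finally have "walk_exits (tl u @ [c]) cs v = \<dots>" .
  moreover have "[0..<length (c # cs)] = 0 # map Suc [0..<length cs]"
    by (simp add: upt_conv_Cons map_Suc_upt del: upt_Suc)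
  ultimately show ?case using Cons.prems by simp
qed simp

lemma sum_length_walk_exits:
  assumes "length u = m" "0 < m"
  shows "(\<Sum>v | length v = m. length (walk_exits u cs v)) = length cs"
  using assms(1)
proof (induction cs arbitrary: u)
  case (Cons c cs)
  have "(\<Sum>v | length v = m. length (walk_exits u (c # cs) v)) =
      (\<Sum>v | length v = m. (if u = v then 1 else 0)) +
      (\<Sum>v | length v = m. length (walk_exits (tl u @ [c]) cs v))"
    unfolding sum.distrib[symmetric] by (rule sum.cong) auto
  also have "(\<Sum>v | length v = m. (if u = v then 1 else 0)) = (1 :: nat)"
    using finite_words[of m "\<lambda>_. True"] Cons.prems by simp
  finally show ?case using Cons.IH[of "tl u @ [c]"] Cons.prems assms(2) by simp
qed simp

text \<open>Read from the end of the walk: prepending a step from \<open>u\<close> changes no last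
  exit if \<open>u\<close> is left again later; otherwise the last exit of \<open>u\<close> leads to
  the next vertex. Membership of the start vertex is carried along so that this next vertex is known
  to be in the tree.\<close>

lemma walk_last_exit_arborescence:
  assumes "length u = m" "0 < m"
  shows "u \<in> {v. walk_exits u cs v \<noteq> []} \<union> {drop (length cs) (u @ cs)} \<and>
    arborescence (drop (length cs) (u @ cs)) (step (\<lambda>v. last (walk_exits u cs v)))
      ({v. walk_exits u cs v \<noteq> []} \<union> {drop (length cs) (u @ cs)})"
  using assms(1)
proof (induction cs arbitrary: u)
  case Nil
  then show ?case by (simp add: arborescence_singleton)
next
  case (Cons c cs)
  let ?u = "tl u @ [c]"
  define r where "r = drop (length cs) (?u @ cs)"
  have r: "drop (length (c # cs)) (u @ c # cs) = r"
    using Cons.prems assms(2) unfolding r_def by (cases u) auto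
  let ?V = "{v. walk_exits ?u cs v \<noteq> []} \<union> {r}"
  have IH: "?u \<in> ?V" "arborescence r (step (\<lambda>v. last (walk_exits ?u cs v))) ?V"
    using Cons.IH[of ?u] Cons.prems assms(2) unfolding r_def by simp_all
  have V: "{v. walk_exits u (c # cs) v \<noteq> []} \<union> {r} = insert u ?V" by auto
  have "arborescence r (step (\<lambda>v. last (walk_exits u (c # cs) v))) (insert u ?V)"
  proof (rule arborescence_insert[OF IH(2)])
    show "u \<in> ?V \<or> step (\<lambda>v. last (walk_exits u (c # cs) v)) u \<in> ?V"
      using IH(1) by (cases "walk_exits ?u cs u = []") simp_all
  qed auto
  then show ?case unfolding r V by simp
qed

text \<open>
  A walk gets stuck only at the root \<open>r\<close>; an unused exit anywhere else would leave an unused last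
  exit on the tree path to \<open>r\<close>, so by balance an unused exit at \<open>r\<close>.
\<close>

lemma walk_exits_surj:
  assumes "arborescence r (step q) {v. length v = m}" "0 < m"
    and "length u = m"
    and "\<And>v. distinct (E v)" "\<And>v. E v \<noteq> [] \<Longrightarrow> length v = m"
    and "\<And>v. length (E v) + (if v = r then 1 else 0) =
      card {e. length e = Suc m \<and> last e \<in> set (E (butlast e)) \<and> tl e = v} + (if v = u then 1 else 0)"
    and "\<And>v. E v \<noteq> [] \<Longrightarrow> v \<noteq> r \<Longrightarrow> last (E v) = q v"
  shows "\<exists>cs. walk_exits u cs = E \<and> drop (length cs) (u @ cs) = r"
  using assms(3-)
proof (induction "card {e. length e = Suc m \<and> last e \<in> set (E (butlast e))}"
    arbitrary: E u rule: less_induct)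
  case less
  note lu = less.prems(1) and dE = less.prems(2) and Elen = less.prems(3)
    and bal = less.prems(4) and lst = less.prems(5)
  let ?A = "{e. length e = Suc m \<and> last e \<in> set (E (butlast e))}"
  let ?In = "\<lambda>v. {e. length e = Suc m \<and> last e \<in> set (E (butlast e)) \<and> tl e = v}"
  have fin: "finite (?In v)" for v using finite_words .
  have edge: "v @ [c] \<in> ?A" if "c \<in> set (E v)" for v c
  proof -
    have "E v \<noteq> []" using that by auto
    then show ?thesis using that Elen[of v] by simp
  qed
  show ?case
  proof (cases "E u = []")
    case True
    then have ur: "u = r" using bal[of u] by (auto split: if_splits)
    have "E v = []" for v
    proof (rule ccontr)
      assume "E v \<noteq> []"
      have "r \<in> {v. E v \<noteq> []}"
      proof (rule arborescence_reaches_root[OF assms(1)])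
        show "{v. E v \<noteq> []} \<subseteq> {v. length v = m}" using Elen by blast
        show "{v. E v \<noteq> []} \<noteq> {}" using \<open>E v \<noteq> []\<close> by blast
        fix w assume w: "w \<in> {v. E v \<noteq> []}" "w \<noteq> r"
        then have "q w \<in> set (E w)" using lst[of w] last_in_set[of "E w"] by simp
        moreover have "w \<noteq> []" using Elen[of w] w assms(2) by auto
        ultimately have "w @ [q w] \<in> ?In (step q w)" using edge[of "q w" w] by simp
        then have "?In (step q w) \<noteq> {}" by (metis empty_iff)
        then have "card (?In (step q w)) \<noteq> 0"
          using fin[of "step q w"] by (simp only: card_eq_0_iff not_False_eq_True simp_thms)
        then have "length (E (step q w)) \<noteq> 0" using bal[of "step q w"] ur by simp
        then show "step q w \<in> {v. E v \<noteq> []}" by simp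
      qed
      then show False using True ur by simp
    qed
    then show ?thesis using ur by (intro exI[of _ "[]"]) auto
  next
    case False
    define c E' where "c = hd (E u)" and "E' = E(u := tl (E u))"
    have Eu: "E u = c # E' u" using False by (simp add: c_def E'_def)
    have EE: "E v = (if u = v then [c] else []) @ E' v" for v using Eu by (simp add: E'_def)
    have cE: "c \<notin> set (E' u)" using dE[of u] Eu by simp
    \<comment> \<open>Using the first exit at \<open>u\<close> deletes exactly the edge
      \<open>u @ [c]\<close>, since \<open>c\<close> does not recur in a distinct list.\<close>
    have A': "last e \<in> set (E' (butlast e)) \<longleftrightarrow> last e \<in> set (E (butlast e)) \<and> e \<noteq> u @ [c]"
      if "length e = Suc m" for e
    proof -
      have "e \<noteq> []" using that by auto
      then have "e = u @ [c] \<longleftrightarrow> butlast e = u \<and> last e = c"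
        by (cases e rule: rev_cases) auto
      then show ?thesis using cE by (auto simp: EE[of "butlast e"])
    qed
    have ucA: "u @ [c] \<in> ?A" using edge[of c u] Eu by simp
    have "\<exists>cs. walk_exits (tl u @ [c]) cs = E' \<and> drop (length cs) ((tl u @ [c]) @ cs) = r"
    proof (rule less.hyps)
      have "{e. length e = Suc m \<and> last e \<in> set (E' (butlast e))} = ?A - {u @ [c]}"
        using A' by auto
      then show "card {e. length e = Suc m \<and> last e \<in> set (E' (butlast e))} < card ?A"
        using ucA finite_words[of "Suc m" "\<lambda>e. last e \<in> set (E (butlast e))"]
        by (simp only: card_Diff1_less)
      show "length (tl u @ [c]) = m" using lu assms(2) by simp
      show "distinct (E' v)" for v using dE[of v] EE[of v] by simp
      show "length v = m" if "E' v \<noteq> []" for v using that Elen[of v] EE[of v] by simp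
      show "last (E' v) = q v" if "E' v \<noteq> []" "v \<noteq> r" for v
        using lst[of v] that EE[of v] by simp
      \<comment> \<open>The step removes an exit at \<open>u\<close> and an entering edge at
        \<open>tl u @ [c]\<close>, and the current vertex moves accordingly; for a loop both changes
        fall on the same vertex and cancel.\<close>
      show "length (E' v) + (if v = r then 1 else 0) =
          card {e. length e = Suc m \<and> last e \<in> set (E' (butlast e)) \<and> tl e = v} +
          (if v = tl u @ [c] then 1 else 0)" for v
      proof -
        have len: "length (E v) = (if v = u then 1 else 0) + length (E' v)"
          using arg_cong[OF EE[of v], of length] by simp
        have "{e. length e = Suc m \<and> last e \<in> set (E' (butlast e)) \<and> tl e = v} = ?In v - {u @ [c]}"
          using A' by auto
        moreover have "u @ [c] \<in> ?In v \<longleftrightarrow> v = tl u @ [c]"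
          using ucA lu assms(2) by (cases u) auto
        ultimately have "card (?In v) =
            card {e. length e = Suc m \<and> last e \<in> set (E' (butlast e)) \<and> tl e = v} +
            (if v = tl u @ [c] then 1 else 0)"
          using card_Suc_Diff1[OF fin[of v], of "u @ [c]"] by (cases "v = tl u @ [c]") simp_all
        then show ?thesis using bal[of v] len by simp
      qed
    qed
    then obtain cs where cs: "walk_exits (tl u @ [c]) cs = E'" "drop (length cs) ((tl u @ [c]) @ cs) = r"
      by blast
    have "walk_exits u (c # cs) = E" using cs(1) EE by (intro ext) simp
    moreover have "drop (length (c # cs)) (u @ c # cs) = r"
      using cs(2) lu assms(2) by (cases u) auto
    ultimately show ?thesis by blast
  qed
qed

subsection \<open>De Bruijn sequences as circuits\<close>

lemma window_Suc: "window b (Suc k) i = window b k i @ [b ! ((i + k) mod length b)]"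
  by (simp add: window_def)

text \<open>Appending the first \<open>k\<close> bits unrolls the cycle; as
  \<open>k \<le> length b\<close>, a window wraps at most once.\<close>

lemma window_eq_take_drop:
  assumes "k \<le> length b" "i \<le> length b"
  shows "window b k i = take k (drop i (b @ take k b))"
proof (rule nth_equalityI)
  show "length (window b k i) = length (take k (drop i (b @ take k b)))"
    using assms by (simp add: window_def)
  fix j assume "j < length (window b k i)"
  then have j: "j < k" by (simp add: window_def)
  show "window b k i ! j = take k (drop i (b @ take k b)) ! j"
  proof (cases "i + j < length b")
    case True
    then have "j < length b - i" by linarith
    then show ?thesis using True j assms by (simp add: window_def nth_append)
  next
    case False
    then have "(i + j) mod length b = i + j - length b"
      using j assms by (simp add: mod_if)
    moreover have "\<not> j < length b - i" "i + j - length b = j - (length b - i)"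
      using False assms by linarith+
    ultimately show ?thesis using j assms by (simp add: window_def nth_append)
  qed
qed

text \<open>The bits read by the circuit from \<open>take m b\<close>: those of the start vertex
  itself are read last, when the circuit closes.\<close>

definition bits_from :: "nat \<Rightarrow> bool list \<Rightarrow> bool list" where
  "bits_from m b = drop m b @ take m b"

lemma length_bits_from [simp]: "length (bits_from m b) = length b"
  by (simp add: bits_from_def)

lemma take_append_bits_from: "take m b @ bits_from m b = b @ take m b"
  by (simp add: bits_from_def)

lemma nth_bits_from:
  assumes "m \<le> length b" "i < length b"
  shows "bits_from m b ! i = b ! ((i + m) mod length b)"
  using assms by (auto simp: bits_from_def nth_append mod_if add.commute)

lemma walk_exits_window:
  assumes "0 < m" "m \<le> length b"
  shows "walk_exits (take m b) (bits_from m b) v =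
    map (\<lambda>i. b ! ((i + m) mod length b)) (filter (\<lambda>i. window b m i = v) [0..<length b])"
proof -
  have len: "length (take m b) = m" using assms(2) by simp
  have "walk_exits (take m b) (bits_from m b) v =
      map ((!) (bits_from m b)) (filter (\<lambda>i. take m (drop i (b @ take m b)) = v) [0..<length b])"
    by (simp only: walk_exits_eq[OF len assms(1)] take_append_bits_from length_bits_from)
  also have "filter (\<lambda>i. take m (drop i (b @ take m b)) = v) [0..<length b] =
      filter (\<lambda>i. window b m i = v) [0..<length b]"
    using assms by (intro filter_cong) (auto simp: window_eq_take_drop)
  also have "map ((!) (bits_from m b)) \<dots> = map (\<lambda>i. b ! ((i + m) mod length b)) \<dots>"
    using assms by (intro map_cong) (auto simp: nth_bits_from)
  finally show ?thesis .
qed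

lemma last_exit_eq:
  assumes "0 < m" "m \<le> length b" "walk_exits (take m b) (bits_from m b) v \<noteq> []"
  shows "last_exit (Suc m) b v = last (walk_exits (take m b) (bits_from m b) v)"
  using assms(3) by (simp add: last_exit_def walk_exits_window[OF assms(1,2)] last_map)

text \<open>Both sides express that \<open>f\<close> is a bijection from the selected positions onto
  its type. This turns unique occurrence of windows into lists of exits that are
  permutations.\<close>

lemma distinct_map_filter_iff:
  "distinct (map f (filter P [0..<N])) \<and> set (map f (filter P [0..<N])) = UNIV \<longleftrightarrow>
    (\<forall>c. \<exists>!i. i < N \<and> P i \<and> f i = c)"
proof -
  let ?S = "{i. i < N \<and> P i}"
  have S: "set (filter P [0..<N]) = ?S" by auto
  have "distinct (map f (filter P [0..<N])) \<and> set (map f (filter P [0..<N])) = UNIV \<longleftrightarrow>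
      bij_betw f ?S UNIV"
    by (simp only: distinct_map set_map S bij_betw_def) simp
  also have "\<dots> \<longleftrightarrow> (\<forall>c. \<exists>!i. i \<in> ?S \<and> f i = c)"
    unfolding bij_betw_def inj_on_def set_eq_iff by (simp add: image_iff) metis
  finally show ?thesis by simp
qed

lemma all_length_Suc_iff:
  "(\<forall>w. length w = Suc m \<longrightarrow> P w) \<longleftrightarrow> (\<forall>v. length v = m \<longrightarrow> (\<forall>c. P (v @ [c])))"
  by (auto simp: length_Suc_conv_rev)

text \<open>A window of length \<open>Suc m\<close> is a vertex followed by the exit taken there, so
  unique occurrence means that every vertex is left once by each bit: the walk is Eulerian.\<close>

lemma de_bruijn_seqs_iff:
  assumes "0 < m"
  shows "b \<in> de_bruijn_seqs (Suc m) \<longleftrightarrow> length b = 2 ^ Suc m \<and>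
    (\<forall>v. length v = m \<longrightarrow> distinct (walk_exits (take m b) (bits_from m b) v) \<and>
       set (walk_exits (take m b) (bits_from m b) v) = UNIV)"
proof (cases "length b = 2 ^ Suc m")
  case True
  have "m \<le> length b" unfolding True using less_exp[of "Suc m"] by linarith
  note w = walk_exits_window[OF assms this]
  have "(\<forall>w. length w = Suc m \<longrightarrow> (\<exists>!i. i < length b \<and> window b (Suc m) i = w)) \<longleftrightarrow>
      (\<forall>v. length v = m \<longrightarrow> (\<forall>c. \<exists>!i. i < length b \<and> window b (Suc m) i = v @ [c]))"
    by (rule all_length_Suc_iff)
  also have "\<dots> \<longleftrightarrow> (\<forall>v. length v = m \<longrightarrow>
      (\<forall>c. \<exists>!i. i < length b \<and> window b m i = v \<and> b ! ((i + m) mod length b) = c))"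
    by (simp add: window_Suc)
  finally show ?thesis
    unfolding w distinct_map_filter_iff using True by (simp add: de_bruijn_seqs_def)
qed (simp add: de_bruijn_seqs_def)

text \<open>Such a list is a bit and its complement, so either end fixes it: the first is used at
  the start vertex, the last elsewhere.\<close>

lemma distinct_UNIV_bool_eqI:
  fixes xs ys :: "bool list"
  assumes "distinct xs" "set xs = UNIV" "distinct ys" "set ys = UNIV"
    and "hd xs = hd ys \<or> last xs = last ys"
  shows "xs = ys"
proof -
  have "length xs = 2" "length ys = 2"
    using distinct_card[OF assms(1)] distinct_card[OF assms(3)] assms(2,4) by simp_all
  then obtain a b c d where "xs = [a, b]" "ys = [c, d]"
    by (auto simp: numeral_2_eq_2 length_Suc_conv)
  then show ?thesis using assms(1,3,5) by auto
qed

section \<open>The circuit and the last-exit tree of a de Bruijn sequence\<close>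

locale de_bruijn_walk =
  fixes m :: nat and b :: "bool list"
  assumes m_pos: "0 < m" and de_bruijn: "b \<in> de_bruijn_seqs (Suc m)"
begin

abbreviation "root \<equiv> take m b"
abbreviation "bit_exits \<equiv> walk_exits root (bits_from m b)"

lemma length_b: "length b = 2 ^ Suc m" and m_less: "m < length b"
proof -
  show "length b = 2 ^ Suc m" using de_bruijn by (simp add: de_bruijn_seqs_def)
  then show "m < length b" using less_exp[of "Suc m"] by linarith
qed

lemma length_root: "length root = m" using m_less by simp

lemma exits_distinct_UNIV:
  "length v = m \<Longrightarrow> distinct (bit_exits v)" "length v = m \<Longrightarrow> set (bit_exits v) = UNIV"
  using de_bruijn unfolding de_bruijn_seqs_iff[OF m_pos] by simp_all

lemma exits_nonempty: "bit_exits v \<noteq> [] \<longleftrightarrow> length v = m"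
  using exits_distinct_UNIV(2)[of v] walk_exits_outside[OF length_root m_pos, of v]
  by (metis UNIV_not_empty list.set(1))

lemma last_exit_last: "length v = m \<Longrightarrow> last_exit (Suc m) b v = last (bit_exits v)"
  using last_exit_eq[OF m_pos] m_less exits_nonempty by simp

lemma hd_exits_root: "hd (bit_exits root) = b ! m"
proof -
  have "drop m b \<noteq> []" using m_less by simp
  then obtain c cs where c: "drop m b = c # cs" by (cases "drop m b") auto
  then have "b ! m = c" using m_less by (metis hd_drop_conv_nth list.sel(1))
  then show ?thesis by (simp add: bits_from_def c)
qed

text \<open>The walk is closed at \<open>root\<close> and leaves every vertex, so the tree of its
  last exits is spanning; \<open>last_exit\<close> agrees with these at all vertices.\<close>

lemma tree_last_exit_circuit: "tree m root (last_exit (Suc m) b)"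
proof -
  have "drop (length (bits_from m b)) (root @ bits_from m b) = root"
    using m_less by (simp add: bits_from_def)
  then have "arborescence root (step (\<lambda>v. last (bit_exits v))) ({v. bit_exits v \<noteq> []} \<union> {root})"
    using walk_last_exit_arborescence[OF length_root m_pos, of "bits_from m b"] by simp
  moreover have "{v. bit_exits v \<noteq> []} \<union> {root} = {v. length v = m}"
    using length_root by (simp add: exits_nonempty insert_absorb)
  ultimately have "arborescence root (step (\<lambda>v. last (bit_exits v))) {v. length v = m}" by simp
  then show ?thesis by (rule arborescence_cong) (simp add: last_exit_last)
qed

end

section \<open>Bijectivity of the code on de Bruijn sequences\<close>

lemma de_bruijn_code_Suc:
  "de_bruijn_code (Suc m) b = b ! m # tree_code m (take m b) (last_exit (Suc m) b)"
  by (simp add: de_bruijn_code_def)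

text \<open>The code reveals the start vertex, its first exit and the last exits elsewhere. These
  fix all lists of exits, hence the bits read and, with the start vertex, the sequence.\<close>

lemma inj_on_de_bruijn_code:
  assumes m: "0 < m"
  shows "inj_on (de_bruijn_code (Suc m)) (de_bruijn_seqs (Suc m))"
proof (rule inj_onI)
  fix b b' assume b: "b \<in> de_bruijn_seqs (Suc m)" "b' \<in> de_bruijn_seqs (Suc m)"
    and eq: "de_bruijn_code (Suc m) b = de_bruijn_code (Suc m) b'"
  interpret B: de_bruijn_walk m b by unfold_locales (use m b in auto)
  interpret B': de_bruijn_walk m b' by unfold_locales (use m b in auto)
  have first: "b ! m = b' ! m" and root: "take m b = take m b'"
    and last: "\<And>v. length v = m \<Longrightarrow> v \<noteq> take m b \<Longrightarrow> last_exit (Suc m) b v = last_exit (Suc m) b' v"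
    using eq tree_code_inj[OF B.tree_last_exit_circuit B'.tree_last_exit_circuit]
    by (auto simp: de_bruijn_code_Suc)
  have "B.bit_exits v = B'.bit_exits v" for v
  proof -
    consider "length v \<noteq> m" | "v = take m b" | "length v = m" "v \<noteq> take m b" by blast
    then show ?thesis
    proof cases
      case 1
      then show ?thesis using B.exits_nonempty B'.exits_nonempty by metis
    next
      case 2
      have l: "length v = m" using B.length_root 2 by simp
      have "hd (B.bit_exits v) = hd (B'.bit_exits v)"
        using B.hd_exits_root B'.hd_exits_root first root 2 by simp
      then show ?thesis
        by (intro distinct_UNIV_bool_eqI B.exits_distinct_UNIV[OF l] B'.exits_distinct_UNIV[OF l] disjI1)
    next
      case 3
      then have "last (B.bit_exits v) = last (B'.bit_exits v)"
        using last[of v] B.last_exit_last B'.last_exit_last by simp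
      then show ?thesis
        by (intro distinct_UNIV_bool_eqI B.exits_distinct_UNIV[OF 3(1)]
            B'.exits_distinct_UNIV[OF 3(1)] disjI2)
    qed
  qed
  then have "B.bit_exits = walk_exits (take m b) (bits_from m b')" unfolding root by (rule ext)
  moreover have "length (bits_from m b) = length (bits_from m b')"
    using B.length_b B'.length_b by (simp add: bits_from_def)
  ultimately have "bits_from m b = bits_from m b'" by (intro walk_exits_inj)
  then have "drop m b = drop m b'"
    using B.length_b B'.length_b by (simp add: bits_from_def)
  then show "b = b'" using root by (metis append_take_drop_id)
qed

lemma de_bruijn_code_surj:
  assumes m: "0 < m" and s: "length s = 2 ^ m"
  shows "\<exists>b\<in>de_bruijn_seqs (Suc m). de_bruijn_code (Suc m) b = s"
proof -
  obtain c s' where s': "s = c # s'" using s by (cases s) auto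
  obtain r p where rp: "tree m r p" "tree_code m r p = s'"
    using tree_code_surj[of s' m] s s' by auto
  have r: "length r = m" using arborescence_root[OF rp(1)] by simp
  \<comment> \<open>At \<open>r\<close> only the first exit is prescribed; elsewhere the parent bit
    \<open>p v\<close> has to come last.\<close>
  define E where "E v = (if length v \<noteq> m then [] else if v = r then [c, \<not> c] else [\<not> p v, p v])"
    for v
  have E: "distinct (E v)" "length v = m \<Longrightarrow> set (E v) = UNIV" for v
    by (auto simp: E_def)
  have "\<exists>cs. walk_exits r cs = E \<and> drop (length cs) (r @ cs) = r"
  proof (rule walk_exits_surj[OF rp(1) m r E(1)])
    show "length v = m" if "E v \<noteq> []" for v using that by (auto simp: E_def split: if_splits)
    show "last (E v) = p v" if "E v \<noteq> []" "v \<noteq> r" for v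
      using that by (auto simp: E_def split: if_splits)
    \<comment> \<open>Both bits are exits at each vertex, so every edge is available and two edges
      enter and leave each vertex; the balance is that of a closed trail at
      \<open>r\<close>.\<close>
    have In: "{e. length e = Suc m \<and> last e \<in> set (E (butlast e)) \<and> tl e = v} =
        {e. length e = Suc m \<and> tl e = v}" for v
      using E(2) by auto
    show "length (E v) + (if v = r then 1 else 0) =
        card {e. length e = Suc m \<and> last e \<in> set (E (butlast e)) \<and> tl e = v} +
        (if v = r then 1 else 0)" for v
    proof (cases "length v = m")
      case True
      then show ?thesis unfolding In entering_eq[OF True] by (simp add: E_def)
    next
      case False
      then have no: "{e. length e = Suc m \<and> tl e = v} = {}" by auto
      show ?thesis unfolding In no using False by (simp add: E_def)
    qed
  qed
  then obtain cs where cs: "walk_exits r cs = E" "drop (length cs) (r @ cs) = r" by blast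
  have N: "length cs = 2 ^ Suc m"
  proof -
    have "length cs = (\<Sum>v | length v = m. length (E v))"
      using sum_length_walk_exits[OF r m, of cs] cs(1) by simp
    also have "\<dots> = (\<Sum>v :: bool list | length v = m. 2)" by (rule sum.cong) (auto simp: E_def)
    also have "\<dots> = 2 ^ Suc m"
      using distinct_card[OF distinct_words[of m]] by (simp add: set_words length_words)
    finally show ?thesis .
  qed
  \<comment> \<open>The walk ends where it began, so \<open>r @ cs = b @ r\<close>: this
    \<open>b\<close> begins with \<open>r\<close>, and \<open>cs\<close> is its rotation by
    \<open>m\<close>.\<close>
  define b where "b = take (length cs) (r @ cs)"
  have mN: "m < length cs" unfolding N using less_exp[of "Suc m"] by linarith
  have root: "take m b = r" using mN r by (simp add: b_def)
  have lb: "length b = length cs" by (simp add: b_def)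
  have "r @ cs = b @ r" using cs(2) append_take_drop_id[of "length cs" "r @ cs"] by (simp add: b_def)
  then have "take m b @ bits_from m b = r @ cs" using take_append_bits_from[of m b] root by simp
  then have bits: "bits_from m b = cs" using root by simp
  have b: "b \<in> de_bruijn_seqs (Suc m)"
    unfolding de_bruijn_seqs_iff[OF m] root bits cs(1) using E lb N by simp
  interpret B: de_bruijn_walk m b by unfold_locales (use m b in auto)
  have "b ! m = c"
    using B.hd_exits_root r unfolding root bits cs(1) by (simp add: E_def)
  \<comment> \<open>The last exit at \<open>r\<close> is \<open>\<not> c\<close>, which need not be
    \<open>p r\<close>; the code depends only on values off the root.\<close>
  moreover have "tree_code m r (last_exit (Suc m) b) = tree_code m r p"
  proof (rule tree_code_cong)
    fix v assume v: "length v = m" "v \<noteq> r"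
    then show "last_exit (Suc m) b v = p v"
      using B.last_exit_last[OF v(1)] unfolding root bits cs(1) by (simp add: E_def)
  qed
  ultimately have "de_bruijn_code (Suc m) b = s"
    using rp(2) s' by (simp add: de_bruijn_code_Suc root)
  then show ?thesis using b by blast
qed

theorem theorem4p1:
  fixes n :: nat
  assumes "n > 1"
  shows "bij_betw (de_bruijn_code n) (de_bruijn_seqs n) {s :: bool list. length s = 2 ^ (n - 1)}"
proof -
  obtain m where n: "n = Suc m" and m: "0 < m" using assms by (cases n) auto
  have "length (de_bruijn_code n b) = 2 ^ m" for b
    using length_tree_code[of m] by (simp add: n de_bruijn_code_Suc)
  then have "de_bruijn_code n ` de_bruijn_seqs n = {s. length s = 2 ^ (n - 1)}"
    using de_bruijn_code_surj[OF m] by (auto simp: n image_iff)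
  then show ?thesis
    using inj_on_de_bruijn_code[OF m] by (simp add: bij_betw_def n)
qed

end
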